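(* Let $r\ge1$ be an integer and let $M\subset\mathbb{Z}\setminus\{0\}$ be a finite set with exactly $r$ elements. Then $M$ is not $(r+1)$-Birkhoff.
   Context: For a positive integer $s$, a set $L\subset\mathbb{Z}\setminus\{0\}$ is $s$-Birkhoff if for every sequence $\{z_i\}_{i\in\mathbb{Z}}$ with values in $\{1,2,\dots,s\}$ there are $m\in L$ and $i\in\mathbb{Z}$ such that $z_i=z_{i+m}$. *)

theory Defs
  imports Main
begin

text \<open>
  The notion is only meant for \<open>s \<ge> 1\<close> and \<open>0 \<notin> L\<close>; both are left to be assumed
  where the predicate is used.
\<close>

definition birkhoff :: "nat \<Rightarrow> int set \<Rightarrow> bool" where
  "birkhoff s L \<longleftrightarrow>
     (\<forall>z :: int \<Rightarrow> nat. (\<forall>i. z i \<in> {1..s}) \<longrightarrow> (\<exists>m\<in>L. \<exists>i. z i = z (i + m)))"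

end

theory Submission
  imports Defs
begin

text \<open>
  Only the absolute values of the elements of \<open>M\<close> matter; they form a set \<open>K\<close> of at most \<open>r\<close>
  positive integers. Colouring the naturals greedily, each position sees at most \<open>r\<close> forbidden
  colours among the earlier ones, so \<open>r + 1\<close> colours suffice. The greedy choice depends only on a
  window of bounded length, so by the pigeonhole principle the window, and hence the colouring,
  is eventually periodic; repeating one period colours all of the integers.
\<close>

text \<open>The orbit of \<open>x\<close> stays in the finite set \<open>S\<close>, so two iterates
  with indices \<open>p < q\<close> agree; from \<open>p\<close> on, the orbit repeats with period
  \<open>q - p\<close>.\<close>

lemma funpow_eventually_periodic:
  fixes f :: "'a \<Rightarrow> 'a"
  assumes "finite S" "x \<in> S" "\<And>y. y \<in> S \<Longrightarrow> f y \<in> S"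
  obtains p T where "T > 0" "\<And>n. (f ^^ (p + n)) x = (f ^^ (p + n mod T)) x"
proof -
  have S: "(f ^^ n) x \<in> S" for n
    by (induction n) (use assms in auto)
  have "finite (range (\<lambda>n. (f ^^ n) x))"
    by (rule finite_subset[OF _ assms(1)]) (use S in blast)
  then have "\<not> inj (\<lambda>n. (f ^^ n) x)"
    using finite_imageD infinite_UNIV_nat by blast
  then obtain p q where pq: "p < q" "(f ^^ p) x = (f ^^ q) x"
    unfolding inj_def by (metis nat_neq_iff)
  define T where "T = q - p"
  have T: "T > 0" "q = T + p" using pq by (auto simp: T_def)
  have per: "(f ^^ (p + (a + T))) x = (f ^^ (p + a)) x" for a
  proof -
    have "(f ^^ (a + q)) x = (f ^^ (a + p)) x"
      by (simp only: funpow_add comp_apply pq(2))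
    then show ?thesis by (simp add: T(2) ac_simps)
  qed
  have "(f ^^ (p + (a + b * T))) x = (f ^^ (p + a)) x" for a b
  proof (induction b)
    case (Suc b)
    then show ?case using per[of "a + b * T"] by (simp add: ac_simps)
  qed simp
  then have "(f ^^ (p + n)) x = (f ^^ (p + n mod T)) x" for n
    by (metis mod_div_mult_eq)
  with T(1) show ?thesis by (rule that)
qed

lemma periodic_coloring_avoiding_differences:
  fixes K :: "nat set"
  assumes "finite K" "0 \<notin> K" "card K < s"
  obtains z :: "int \<Rightarrow> nat"
  where "\<And>i. z i \<in> {1..s}" "\<And>i k. k \<in> K \<Longrightarrow> z (i + int k) \<noteq> z i"
proof -
  \<comment> \<open>The window reaches back past the largest difference; \<open>insert 0\<close>
    covers empty \<open>K\<close>, and \<open>Suc\<close> ensures that a window has a head.\<close>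
  define N where "N = Suc (Max (insert 0 K))"
  have KN: "k < N" if "k \<in> K" for k
    using that assms(1) by (simp add: N_def less_Suc_eq_le)
  \<comment> \<open>Index \<open>k - 1\<close> holds the colour \<open>k\<close> places before the
    one to be chosen. Only the number of forbidden values is counted, so \<open>w\<close> may be any
    list.\<close>
  have "\<exists>x \<in> {1..s}. x \<notin> (\<lambda>k. w ! (k - 1)) ` K" for w :: "nat list"
  proof (rule ccontr)
    assume "\<not> ?thesis"
    then have "card {1..s} \<le> card ((\<lambda>k. w ! (k - 1)) ` K)"
      by (intro card_mono) (use assms(1) in auto)
    also have "\<dots> \<le> card K" by (rule card_image_le[OF assms(1)])
    finally show False using assms(3) by simp
  qed
  then obtain g where g: "\<And>w. g w \<in> {1..s}" "\<And>w. g w \<notin> (\<lambda>k. w ! (k - 1)) ` K"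
    by metis
  \<comment> \<open>A window lists the most recent colours, newest first.\<close>
  define step where "step w = g w # butlast w" for w
  define S where "S = {w. set w \<subseteq> {1..s} \<and> length w = N}"
  have finS: "finite S" unfolding S_def by (rule finite_lists_length_eq) simp
  \<comment> \<open>The initial window may repeat colours freely: only heads of windows enter the
    colouring.\<close>
  have init: "replicate N 1 \<in> S"
    using assms(3) by (auto simp: S_def)
  have stepS: "step w \<in> S" if "w \<in> S" for w
    using that g(1)[of w] by (auto simp: S_def step_def N_def dest: in_set_butlastD)
  obtain p T where T: "T > 0"
    and per: "\<And>n. (step ^^ (p + n)) (replicate N 1) = (step ^^ (p + n mod T)) (replicate N 1)"
    using funpow_eventually_periodic[where f = step, OF finS init stepS] by metis
  define W where "W n = (step ^^ n) (replicate N 1)" for n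
  have W_Suc: "W (Suc n) = step (W n)" for n by (simp add: W_def)
  have WS: "W n \<in> S" for n
  proof (induction n)
    case 0
    then show ?case using init by (simp add: W_def)
  next
    case (Suc n)
    then show ?case by (simp add: W_Suc stepS)
  qed
  have len: "length (W n) = N" for n using WS[of n] by (simp add: S_def)
  \<comment> \<open>Each step pushes a colour one place to the right, until it drops off the
    end.\<close>
  have shift: "W (n + j) ! j = W n ! 0" if "j < N" for n j
    using that
  proof (induction j)
    case (Suc j)
    then show ?case using len[of "n + j"] by (simp add: W_Suc step_def nth_butlast)
  qed simp
  have avoid: "W (n + k) ! 0 \<noteq> W n ! 0" if "k \<in> K" for n k
  proof -
    from that assms(2) have "k \<noteq> 0" by metis
    then obtain j where j: "k = Suc j" using not0_implies_Suc by blast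
    have "W (n + k) ! 0 = g (W (n + j))" by (simp add: j W_Suc step_def)
    moreover have "g (W (n + j)) \<noteq> W (n + j) ! j"
      using g(2)[of "W (n + j)"] \<open>k \<in> K\<close> j by force
    moreover have "W (n + j) ! j = W n ! 0" using shift KN[OF \<open>k \<in> K\<close>] j by simp
    ultimately show ?thesis by simp
  qed
  define z where "z i = W (p + nat (i mod int T)) ! 0" for i
  show ?thesis
  proof (rule that[of z])
    show "z i \<in> {1..s}" for i
    proof -
      have "W n ! 0 \<in> set (W n)" for n by (rule nth_mem) (simp add: len N_def)
      then show ?thesis using WS unfolding z_def S_def by blast
    qed
    show "z (i + int k) \<noteq> z i" if "k \<in> K" for i k
    proof -
      define a where "a = nat (i mod int T)"
      have a: "int a = i mod int T" using T by (simp add: a_def)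
      have "(i + int k) mod int T = int ((a + k) mod T)"
        by (simp add: zmod_int a mod_simps)
      \<comment> \<open>By periodicity, a difference that wraps around the period becomes a genuine
        forward difference \<open>k\<close> in the greedy sequence.\<close>
      then have "z (i + int k) = W (p + (a + k)) ! 0"
        using per[of "a + k"] by (simp add: z_def W_def)
      then show ?thesis using avoid[OF that, of "p + a"] by (simp add: z_def a_def ac_simps)
    qed
  qed
qed

theorem mainTheorem5:
  fixes r :: nat and M :: "int set"
  assumes "r \<ge> 1"
    and "M \<subseteq> UNIV - {0}"
    and "finite M"
    and "card M = r"
  shows "\<not> birkhoff (r + 1) M"
proof -
  define K where "K = (\<lambda>m. nat \<bar>m\<bar>) ` M"
  have "finite K" "0 \<notin> K" using assms(2,3) by (auto simp: K_def)
  moreover have "card K < r + 1"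
    using card_image_le[OF assms(3), of "\<lambda>m. nat \<bar>m\<bar>"] assms(4) by (simp add: K_def)
  ultimately obtain z :: "int \<Rightarrow> nat" where z: "\<And>i. z i \<in> {1..r + 1}"
    "\<And>i k. k \<in> K \<Longrightarrow> z (i + int k) \<noteq> z i"
    using periodic_coloring_avoiding_differences by blast
  have "z i \<noteq> z (i + m)" if "m \<in> M" for i m
  proof -
    have K: "nat \<bar>m\<bar> \<in> K" using that by (simp add: K_def)
    show ?thesis
    proof (cases "m \<ge> 0")
      case True
      then show ?thesis using z(2)[OF K, of i] by simp
    next
      case False
      \<comment> \<open>For negative \<open>m\<close>, the point \<open>i\<close> lies \<bar>m\<bar>
        to the right of \<open>i + m\<close>.\<close>
      then show ?thesis using z(2)[OF K, of "i + m"] by simp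
    qed
  qed
  with z(1) show ?thesis unfolding birkhoff_def by blast
qed

end
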